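(* If $\mathrm{BallCenterBundle}$ holds, then the topology of geometric point-open plurals is not discrete; that is, it is not the case that for every name $u$, $\mathrm{GPointPlural}(u)$ implies $\mathrm{GPointOpen}(u)$.
   Context: Logic is classical. Names form a type $N$; a name may designate zero, one or several objects. The relation $\eta : N\to N\to \mathrm{Prop}$ (singular inclusion) is governed by Leśniewski's Ontology: $\eta\,A\,b$ holds iff [there is $C$ with $\eta\,C\,A$] and [for all $C,D$, $\eta\,C\,A$ and $\eta\,D\,A$ imply $\eta\,C\,D$] and [for all $C$, $\eta\,C\,A$ implies $\eta\,C\,b$]; i.e. $A$ designates exactly one object, which is among those designated by $b$. $A$ is an Individual iff $\eta\,A\,A$. Notation: $P\equiv Q$ iff $\eta\,P\,Q$ and $\eta\,Q\,P$; $a\approx b$ iff $\forall P,\ \eta\,P\,a\leftrightarrow\eta\,P\,b$. Names with the same extension are interchangeable. Name-forming operators are introduced by stating when $\eta\,P\,(\cdot)$ holds. Mereology: $\eta\,P\,(\mathrm{pt}(Q))$ ("$P$ is a part of $Q$") relates individuals and is reflexive on individuals, transitive, and antisymmetric up to $\equiv$; a proper part of $Q$ is a part $P$ with not $P\equiv Q$; $\eta\,P\,(\mathrm{ext}(Q))$ ("$P$ is external to $Q$") means $P,Q$ are individuals with no common part. Geometry: $\mathrm{balls}$ is a primitive name whose members are individuals (balls); at least one ball exists. $\eta\,P\,(\mathrm{Concent}(Q))$ means that the balls $P,Q$ are concentric in Tarski's sense: $P\equiv Q$; or $P$ is a proper part of $Q$ and any two balls $X,Y$ externally diametrical to $P$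 and internally tangent to $Q$ are internally diametrical to $Q$; or the same with $P,Q$ exchanged. Here (all variables balls): $A$ is externally tangent to $B$ if $A$ is external to $B$ and of any two balls $X,Y$ having $A$ as part and external to $B$ one is part of the other; $A$ is internally tangent to $B$ if $A$ is a proper part of $B$ and of any two balls $X,Y$ having $A$ as part and being parts of $B$ one is part of the other; $A,B$ are externally diametrical to $C$ if both are externally tangent to $C$ and whenever $X,Y$ are external to $C$, $A$ is part of $X$ and $B$ is part of $Y$, then $X$ is external to $Y$; $A,B$ are internally diametrical to $C$ if both are internally tangent to $C$ and whenever $X,Y$ are external to $C$, $A$ is externally tangent to $X$ and $B$ to $Y$, then $X$ is external to $Y$. $\eta\,P\,(\mathrm{Point}(Q))$ iff $\eta\,P\,\mathrm{balls}$, $\eta\,Q\,\mathrm{balls}$ and $\eta\,P\,(\mathrm{Concent}(Q))$. Standing assumptions: concentricity is an equivalence relation on balls, and concentric balls $P,Q$ satisfy $\mathrm{Point}(P)\approx\mathrm{Point}(Q)$. Point-class notions: $\mathrm{same\_center}(P,Q)$ iff $\mathrm{Point}(P)\approx\mathrm{Point}(Q)$. $\mathrm{PointSet\_incl}(u,v)$ iff for all $B$ with $\eta\,B\,\mathrm{balls}$, $\eta\,B\,u$ implies $\eta\,B\,v$. $\mathrm{PointSet\_stable}(u)$ iff for all $B,C$, $\mathrm{same\_center}(B,C)$ and $\eta\,B\,u$ imply $\eta\,C\,u$. $\mathrm{GPointPlural}(u)$ iff $\mathrm{PointSet\_stable}(u)$ and every $P$ with $\eta\,P\,u$ satisfies $\eta\,P\,\mathrm{balls}$.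 $\eta\,P\,\mathrm{GBasicPointSet}(Q)$ iff $\eta\,Q\,\mathrm{balls}$, $\eta\,P\,\mathrm{balls}$ and there is $C$ with $\eta\,C\,\mathrm{balls}$, $\mathrm{same\_center}(P,C)$ and $\eta\,C\,(\mathrm{pt}(Q))$. $\mathrm{GPointOpen}(u)$ iff $\mathrm{PointSet\_stable}(u)$; and every $P$ with $\eta\,P\,u$ satisfies $\eta\,P\,\mathrm{balls}$; and for every $P$ with $\eta\,P\,u$ there is $Q$ with $\eta\,Q\,\mathrm{balls}$, $\eta\,P\,\mathrm{GBasicPointSet}(Q)$ and $\mathrm{PointSet\_incl}(\mathrm{GBasicPointSet}(Q),u)$. $\mathrm{BallCenterBundle}$ is the proposition: for every $B$ with $\eta\,B\,\mathrm{balls}$ there is $C$ with $\eta\,C\,\mathrm{balls}$, $\eta\,C\,(\mathrm{pt}(B))$ and not $\mathrm{same\_center}(C,B)$. *)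

theory Defs
  imports Main
begin

locale names =
  fixes eta :: "'n \<Rightarrow> 'n \<Rightarrow> bool"
begin

definition individual :: "'n \<Rightarrow> bool" where
  "individual A \<longleftrightarrow> eta A A"

definition same_object :: "'n \<Rightarrow> 'n \<Rightarrow> bool" where
  "same_object P Q \<longleftrightarrow> eta P Q \<and> eta Q P"

definition same_extension :: "'n \<Rightarrow> 'n \<Rightarrow> bool" where
  "same_extension a b \<longleftrightarrow> (\<forall>P. eta P a \<longleftrightarrow> eta P b)"

end

(* Interchangeability of co-extensional names in every context is Leibniz equality,
   hence equality in HOL. *)
locale ontology = names eta for eta :: "'n \<Rightarrow> 'n \<Rightarrow> bool" +
  assumes eta_iff:
    "eta A b \<longleftrightarrow>
      (\<exists>C. eta C A) \<and>
      (\<forall>C D. eta C A \<and> eta D A \<longrightarrow> eta C D) \<and>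
      (\<forall>C. eta C A \<longrightarrow> eta C b)"
    and interchangeable: "same_extension a b \<Longrightarrow> a = b"

(* Here and below, a name-forming operator is a function on names together with the
   equivalence stating which names it contains. *)
locale mereology = ontology eta for eta :: "'n \<Rightarrow> 'n \<Rightarrow> bool" +
  fixes pt :: "'n \<Rightarrow> 'n"
    and ext :: "'n \<Rightarrow> 'n"
  assumes pt_individual: "eta P (pt Q) \<Longrightarrow> individual P \<and> individual Q"
    and pt_refl: "individual P \<Longrightarrow> eta P (pt P)"
    and pt_trans: "eta P (pt Q) \<Longrightarrow> eta Q (pt R) \<Longrightarrow> eta P (pt R)"
    and pt_antisym: "eta P (pt Q) \<Longrightarrow> eta Q (pt P) \<Longrightarrow> same_object P Q"
    and ext_iff:
      "eta P (ext Q) \<longleftrightarrow>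
        individual P \<and> individual Q \<and> \<not> (\<exists>R. eta R (pt P) \<and> eta R (pt Q))"
begin

definition proper_part :: "'n \<Rightarrow> 'n \<Rightarrow> bool" where
  "proper_part P Q \<longleftrightarrow> eta P (pt Q) \<and> \<not> same_object P Q"

end

locale mereology_balls = mereology eta pt ext
  for eta :: "'n \<Rightarrow> 'n \<Rightarrow> bool" and pt ext :: "'n \<Rightarrow> 'n" +
  fixes balls :: 'n
  assumes ball_individual: "eta P balls \<Longrightarrow> individual P"
    and ball_exists: "\<exists>B. eta B balls"
begin

definition externally_tangent :: "'n \<Rightarrow> 'n \<Rightarrow> bool" where
  "externally_tangent A B \<longleftrightarrow>
    eta A balls \<and> eta B balls \<and> eta A (ext B) \<and>
    (\<forall>X Y. eta X balls \<and> eta Y balls \<and>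
        eta A (pt X) \<and> eta X (ext B) \<and> eta A (pt Y) \<and> eta Y (ext B) \<longrightarrow>
        eta X (pt Y) \<or> eta Y (pt X))"

definition internally_tangent :: "'n \<Rightarrow> 'n \<Rightarrow> bool" where
  "internally_tangent A B \<longleftrightarrow>
    eta A balls \<and> eta B balls \<and> proper_part A B \<and>
    (\<forall>X Y. eta X balls \<and> eta Y balls \<and>
        eta A (pt X) \<and> eta X (pt B) \<and> eta A (pt Y) \<and> eta Y (pt B) \<longrightarrow>
        eta X (pt Y) \<or> eta Y (pt X))"

definition externally_diametrical :: "'n \<Rightarrow> 'n \<Rightarrow> 'n \<Rightarrow> bool" where
  "externally_diametrical A B C \<longleftrightarrow>
    externally_tangent A C \<and> externally_tangent B C \<and>
    (\<forall>X Y. eta X balls \<and> eta Y balls \<and>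
        eta X (ext C) \<and> eta Y (ext C) \<and> eta A (pt X) \<and> eta B (pt Y) \<longrightarrow>
        eta X (ext Y))"

definition internally_diametrical :: "'n \<Rightarrow> 'n \<Rightarrow> 'n \<Rightarrow> bool" where
  "internally_diametrical A B C \<longleftrightarrow>
    internally_tangent A C \<and> internally_tangent B C \<and>
    (\<forall>X Y. eta X balls \<and> eta Y balls \<and>
        eta X (ext C) \<and> eta Y (ext C) \<and>
        externally_tangent A X \<and> externally_tangent B Y \<longrightarrow>
        eta X (ext Y))"

definition concentric_inside :: "'n \<Rightarrow> 'n \<Rightarrow> bool" where
  "concentric_inside P Q \<longleftrightarrow>
    proper_part P Q \<and>
    (\<forall>X Y. eta X balls \<and> eta Y balls \<and> externally_diametrical X Y P \<and>
        internally_tangent X Q \<and> internally_tangent Y Q \<longrightarrow>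
        internally_diametrical X Y Q)"

end

locale solid_geometry = mereology_balls eta pt ext balls
  for eta :: "'n \<Rightarrow> 'n \<Rightarrow> bool" and pt ext :: "'n \<Rightarrow> 'n" and balls :: 'n +
  fixes Concent :: "'n \<Rightarrow> 'n"
    and Point :: "'n \<Rightarrow> 'n"
  assumes Concent_iff:
    "eta P (Concent Q) \<longleftrightarrow>
      eta P balls \<and> eta Q balls \<and>
      (same_object P Q \<or> concentric_inside P Q \<or> concentric_inside Q P)"
    and Point_iff:
      "eta P (Point Q) \<longleftrightarrow> eta P balls \<and> eta Q balls \<and> eta P (Concent Q)"
    and Concent_equiv: "equiv {B. eta B balls} {(P, Q). eta P (Concent Q)}"
    and Concent_Point:
      "eta P balls \<Longrightarrow> eta Q balls \<Longrightarrow> eta P (Concent Q) \<Longrightarrow>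
        same_extension (Point P) (Point Q)"
begin

definition same_center :: "'n \<Rightarrow> 'n \<Rightarrow> bool" where
  "same_center P Q \<longleftrightarrow> same_extension (Point P) (Point Q)"

definition PointSet_incl :: "'n \<Rightarrow> 'n \<Rightarrow> bool" where
  "PointSet_incl u v \<longleftrightarrow> (\<forall>B. eta B balls \<longrightarrow> eta B u \<longrightarrow> eta B v)"

definition PointSet_stable :: "'n \<Rightarrow> bool" where
  "PointSet_stable u \<longleftrightarrow> (\<forall>B C. same_center B C \<and> eta B u \<longrightarrow> eta C u)"

definition GPointPlural :: "'n \<Rightarrow> bool" where
  "GPointPlural u \<longleftrightarrow> PointSet_stable u \<and> (\<forall>P. eta P u \<longrightarrow> eta P balls)"

definition BallCenterBundle :: bool where
  "BallCenterBundle \<longleftrightarrow>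
    (\<forall>B. eta B balls \<longrightarrow>
      (\<exists>C. eta C balls \<and> eta C (pt B) \<and> \<not> same_center C B))"

end

locale point_geometry = solid_geometry eta pt ext balls Concent Point
  for eta :: "'n \<Rightarrow> 'n \<Rightarrow> bool" and pt ext :: "'n \<Rightarrow> 'n" and balls :: 'n
    and Concent Point :: "'n \<Rightarrow> 'n" +
  fixes GBasicPointSet :: "'n \<Rightarrow> 'n"
  assumes GBasicPointSet_iff:
    "eta P (GBasicPointSet Q) \<longleftrightarrow>
      eta Q balls \<and> eta P balls \<and>
      (\<exists>C. eta C balls \<and> same_center P C \<and> eta C (pt Q))"
begin

definition GPointOpen :: "'n \<Rightarrow> bool" where
  "GPointOpen u \<longleftrightarrow>
    PointSet_stable u \<and>
    (\<forall>P. eta P u \<longrightarrow> eta P balls) \<and>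
    (\<forall>P. eta P u \<longrightarrow>
      (\<exists>Q. eta Q balls \<and> eta P (GBasicPointSet Q) \<and>
        PointSet_incl (GBasicPointSet Q) u))"

end

end

theory Submission imports Defs begin

text \<open>
  A discrete topology would make a single geometric point open. For a ball \<open>B\<close>, the name
  \<open>Point B\<close> lists the balls concentric with \<open>B\<close>, so it represents one point; it is closed under
  change of concentric representative and therefore is a geometric plural
  (\<open>GPointPlural_Point\<close>). If it were open, some basic set of a ball \<open>Q\<close> would lie inside it.
  But that basic set contains \<open>Q\<close> itself and every ball that is part of \<open>Q\<close>, so all these balls
  would share the center of \<open>B\<close>, whereas \<open>BallCenterBundle\<close> provides a ball inside \<open>Q\<close> with
  another center (\<open>not_GPointOpen_Point\<close>).
\<close>

context solid_geometry
begin

text \<open>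
  A ball belongs to its own point. Hence, if the points of \<open>P\<close> and \<open>Q\<close> coincide, \<open>P\<close> belongs to
  the point of \<open>Q\<close>. This direction forces \<open>Q\<close> to be a ball, because a name other than a ball has
  an empty point.
\<close>

lemma same_center_iff_Point:
  assumes "eta P balls"
  shows "same_center P Q \<longleftrightarrow> eta P (Point Q)"
proof
  have "eta P (Point P)"
    using assms Concent_iff Point_iff ball_individual
    unfolding individual_def same_object_def by blast
  moreover assume "same_center P Q"
  ultimately show "eta P (Point Q)"
    unfolding same_center_def same_extension_def by blast
next
  assume "eta P (Point Q)"
  then show "same_center P Q"
    unfolding same_center_def using Point_iff Concent_Point by blast
qed

lemma same_center_sym: "same_center P Q \<Longrightarrow> same_center Q P"
  unfolding same_center_def same_extension_def by simp

lemma same_center_trans: "same_center P Q \<Longrightarrow> same_center Q R \<Longrightarrow> same_center P R"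
  unfolding same_center_def same_extension_def by simp

lemma GPointPlural_Point: "GPointPlural (Point B)"
  unfolding GPointPlural_def PointSet_stable_def
proof (intro conjI allI impI)
  fix P Q
  assume PQ: "same_center P Q \<and> eta P (Point B)"
  then have P: "eta P balls"
    using Point_iff by blast
  with PQ have "eta Q balls" and "same_center P B"
    using same_center_iff_Point Point_iff by blast+
  with PQ show "eta Q (Point B)"
    using same_center_iff_Point same_center_sym same_center_trans by blast
qed (use Point_iff in blast)

end

context point_geometry
begin

lemma ball_part_in_GBasicPointSet:
  assumes "eta Q balls" "eta P balls" "eta P (pt Q)"
  shows "eta P (GBasicPointSet Q)"
  using assms GBasicPointSet_iff unfolding same_center_def same_extension_def by blast

lemma not_GPointOpen_Point:
  assumes BallCenterBundle and B: "eta B balls"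
  shows "\<not> GPointOpen (Point B)"
proof
  assume "GPointOpen (Point B)"
  moreover have "eta B (Point B)"
    using B same_center_iff_Point unfolding same_center_def same_extension_def by blast
  ultimately obtain Q where Q: "eta Q balls"
    and incl: "PointSet_incl (GBasicPointSet Q) (Point B)"
    unfolding GPointOpen_def by blast
  have center: "same_center P B" if "eta P balls" "eta P (pt Q)" for P
    using that Q incl ball_part_in_GBasicPointSet same_center_iff_Point
    unfolding PointSet_incl_def by blast
  obtain C where "eta C balls" "eta C (pt Q)" "\<not> same_center C Q"
    using assms(1) Q unfolding BallCenterBundle_def by blast
  moreover have "eta Q (pt Q)"
    using Q ball_individual pt_refl by blast
  ultimately show False
    using Q center same_center_sym same_center_trans by blast
qed

end

theorem mainTheorem12:
  fixes eta :: "'n \<Rightarrow> 'n \<Rightarrow> bool"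
    and pt ext Concent Point GBasicPointSet :: "'n \<Rightarrow> 'n"
    and balls :: 'n
  assumes "point_geometry eta pt ext balls Concent Point GBasicPointSet"
    and "solid_geometry.BallCenterBundle eta pt balls Point"
  shows "\<not> (\<forall>u. solid_geometry.GPointPlural eta balls Point u \<longrightarrow>
               point_geometry.GPointOpen eta balls Point GBasicPointSet u)"
proof -
  interpret point_geometry eta pt ext balls Concent Point GBasicPointSet
    by (fact assms(1))
  obtain B where "eta B balls"
    using ball_exists by blast
  then show ?thesis
    using assms(2) GPointPlural_Point not_GPointOpen_Point by blast
qed

end
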